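(* Let $p_H^r\in\mathbb{R}^3$ be constant with $z_W^\top p_H^r=0$, let $0<f_z<m_Hg$, and set $f_c^r=f_zz_W$, $p_R^r=p_H^r+f_c^r\left(\frac1{k_c}+\frac{\bar l_c}{\|f_c^r\|}\right)$. Consider the system with state $x=[p_H^\top\ v_H^\top\ p_R^\top\ v_R^\top]^\top\in\mathcal{X}$, subject to an additional human force $u_H\in\mathbb{R}^3$, with dynamics $$\dot p_H=v_H,\quad \dot v_H=\tfrac1{m_H}\left(-m_Hg\,z_W-B_Hv_H+f_c+f_g+u_H\right),\quad \dot p_R=v_R,\quad \dot v_R=M_A^{-1}\left(-B_Av_R-f_c+u_A\right),$$ under the control law $u_A=K_H(p_R^r-p_R)+f_c^r$. Then this system is output-strictly passive with respect to the input-output pair $(u_2,y_2)=(u_H,v_H)$, with storage function $$V(x)=\tfrac12\left(m_Hv_H^\top v_H+v_R^\top M_Av_R+e_R^\top K_He_R\right)+\int_{l_{c0}}^{\|l_c\|}t_c(\tau)\,d\tau-l_c^\top f_c^r+V_0,\qquad e_R=p_R^r-p_R,\ \ l_c=p_R-p_H,$$ where $l_{c0}=\|l_c(0)\|$ and $V_0$ is the constant such that $V(\bar x)=0$ for $\bar x=[(p_H^r)^\top\ 0^\top\ (p_R^r)^\top\ 0^\top]^\top$.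
   Context: Constants: $m_H,g,k_c,\bar l_c,k_H>0$; $B_H\in\mathbb{R}^{3\times3}$ positive definite; $M_A,B_A\in\mathbb{R}^{3\times 3}$ positive definite diagonal; $K_H=\mathrm{diag}(k_H,k_H,0)$. $\{x_W,y_W,z_W\}$ is the canonical orthonormal basis of $\mathbb{R}^3$, with $z_W$ pointing vertically upward. $p_H,v_H\in\mathbb{R}^3$ are the position and velocity of the human (hand), and $p_R,v_R\in\mathbb{R}^3$ those of the aerial robot. Cable force: let $l_c=p_R-p_H$ and define the tension $t_c(\ell)=k_c(\ell-\bar l_c)$ if $\ell>\bar l_c$ and $t_c(\ell)=0$ otherwise. The cable force on the human is $f_c=t_c(\|l_c\|)\,l_c/\|l_c\|$ (equal to $0$ when $\|l_c\|\le\bar l_c$, including $l_c=0$). The force on the robot is $-f_c$. Ground constraint: the ground is flat and horizontal and the human is constrained to it, i.e. the state space is $\mathcal{X}=\{x\in\mathbb{R}^{12}: z_W^\top p_H=0,\ z_W^\top v_H=0\}$. The ground reaction $f_g$ is vertical, $f_g=\lambda z_W$, where the scalar $\lambda$ is the value for which $z_W^\top\dot v_H=0$. It is a standing assumption that the human stays on the ground (the reaction intensity satisfies $\lambda\ge 0$; the human is never lifted). Output-strict passivity (Khalil): a system with input $u$ and output $y$ of the same dimension is output-strictly passive with storage function $V$ if $V$ is continuously differentiable and positive semidefinite ($V\ge0$ on $\mathcal{X}$), and there is a function $\phi$ with $y^\top\phi(y)>0$ for all $y\neq0$ such that, along the system dynamics, $\dot V\le u^\top y-y^\top\phi(y)$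 for every state and every input value. *)

theory Defs
  imports "HOL-Analysis.Analysis"
begin

type_synonym vec3 = "real ^ 3"
type_synonym mat3 = "real ^ 3 ^ 3"

definition continuously_differentiable :: "('a::real_normed_vector \<Rightarrow> real) \<Rightarrow> bool" where
  "continuously_differentiable V \<longleftrightarrow>
     (\<exists>V' :: 'a \<Rightarrow> 'a \<Rightarrow>\<^sub>L real.
        (\<forall>x. (V has_derivative blinfun_apply (V' x)) (at x)) \<and> continuous_on UNIV V')"

text \<open>
  The system is \<open>x' = f x u\<close>, \<open>y = h x u\<close> with state space \<open>X\<close>; input and output range over the
  same inner product space. The derivative of \<open>V\<close> along the dynamics is the Frechet derivative
  of \<open>V\<close> at \<open>x\<close> applied to \<open>f x u\<close>. The function \<open>V\<close> is differentiable on the ambient space of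
  \<open>X\<close>, so that this derivative is unambiguous even though \<open>X\<close> may have empty interior.
\<close>

definition output_strictly_passive ::
  "'x::real_normed_vector set \<Rightarrow> ('x \<Rightarrow> 'u::real_inner \<Rightarrow> 'x) \<Rightarrow> ('x \<Rightarrow> 'u \<Rightarrow> 'u) \<Rightarrow> ('x \<Rightarrow> real) \<Rightarrow> bool"
  where
  "output_strictly_passive X f h V \<longleftrightarrow>
     continuously_differentiable V \<and> (\<forall>x\<in>X. V x \<ge> 0) \<and>
     (\<exists>\<phi> :: 'u \<Rightarrow> 'u. (\<forall>y. y \<noteq> 0 \<longrightarrow> y \<bullet> \<phi> y > 0) \<and>
        (\<forall>x\<in>X. \<forall>u. frechet_derivative V (at x) (f x u) \<le> u \<bullet> h x u - h x u \<bullet> \<phi> (h x u)))"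

text \<open>Symmetry is not part of positive definiteness here.\<close>

definition pos_def :: "real ^ 'n ^ 'n \<Rightarrow> bool" where
  "pos_def A \<longleftrightarrow> (\<forall>x. x \<noteq> 0 \<longrightarrow> x \<bullet> (A *v x) > 0)"

definition diagonal :: "real ^ 'n ^ 'n \<Rightarrow> bool" where
  "diagonal A \<longleftrightarrow> (\<forall>i j. i \<noteq> j \<longrightarrow> A $ i $ j = 0)"

definition K_H :: "real \<Rightarrow> mat3" where
  "K_H kH = vector [vector [kH, 0, 0], vector [0, kH, 0], vector [0, 0, 0]]"

definition z_W :: vec3 where
  "z_W = axis 3 1"

text \<open>A state is \<open>(p\<^sub>H, v\<^sub>H, p\<^sub>R, v\<^sub>R)\<close>.\<close>

type_synonym state = "vec3 \<times> vec3 \<times> vec3 \<times> vec3"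

definition state_space :: "state set" where
  "state_space = {(pH, vH, pR, vR). z_W \<bullet> pH = 0 \<and> z_W \<bullet> vH = 0}"

fun human_velocity :: "state \<Rightarrow> vec3" where
  "human_velocity (pH, vH, pR, vR) = vH"

fun cable_vector :: "state \<Rightarrow> vec3" where
  "cable_vector (pH, vH, pR, vR) = pR - pH"

definition tension :: "real \<Rightarrow> real \<Rightarrow> real \<Rightarrow> real" where
  "tension kc lbar l = (if l > lbar then kc * (l - lbar) else 0)"

definition cable_force :: "real \<Rightarrow> real \<Rightarrow> vec3 \<Rightarrow> vec3" where
  "cable_force kc lbar lc = (tension kc lbar (norm lc) / norm lc) *\<^sub>R lc"

definition human_acceleration ::
  "real \<Rightarrow> real \<Rightarrow> mat3 \<Rightarrow> vec3 \<Rightarrow> vec3 \<Rightarrow> vec3 \<Rightarrow> vec3 \<Rightarrow> vec3" where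
  "human_acceleration mH g BH vH fc fg uH =
     (1 / mH) *\<^sub>R (- ((mH * g) *\<^sub>R z_W) - BH *v vH + fc + fg + uH)"

text \<open>
  The reaction intensity is the multiplier of the ground constraint. For some inputs it is negative,
  i.e. the contact would be lost; the standing assumption that the human stays on the ground
  amounts to using the constrained dynamics throughout, so no state or input is excluded.
\<close>

definition reaction_intensity ::
  "real \<Rightarrow> real \<Rightarrow> mat3 \<Rightarrow> vec3 \<Rightarrow> vec3 \<Rightarrow> vec3 \<Rightarrow> real" where
  "reaction_intensity mH g BH vH fc uH =
     (THE lam. z_W \<bullet> human_acceleration mH g BH vH fc (lam *\<^sub>R z_W) uH = 0)"

definition control_law :: "real \<Rightarrow> vec3 \<Rightarrow> vec3 \<Rightarrow> vec3 \<Rightarrow> vec3" where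
  "control_law kH pRr fcr pR = K_H kH *v (pRr - pR) + fcr"

fun closed_loop ::
  "real \<Rightarrow> real \<Rightarrow> real \<Rightarrow> real \<Rightarrow> real \<Rightarrow> mat3 \<Rightarrow> mat3 \<Rightarrow> mat3 \<Rightarrow> vec3 \<Rightarrow> vec3 \<Rightarrow> state \<Rightarrow> vec3 \<Rightarrow> state"
  where
  "closed_loop mH g kc lbar kH BH MA BA pRr fcr (pH, vH, pR, vR) uH =
     (let fc = cable_force kc lbar (pR - pH);
          fg = reaction_intensity mH g BH vH fc uH *\<^sub>R z_W;
          uA = control_law kH pRr fcr pR
      in (vH,
          human_acceleration mH g BH vH fc fg uH,
          vR,
          matrix_inv MA *v (- (BA *v vR) - fc + uA)))"

text \<open>
  The interval integral is oriented, hence meaningful also when the cable is shorter than the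
  reference length \<open>lc0\<close>.
\<close>

fun storage ::
  "real \<Rightarrow> real \<Rightarrow> real \<Rightarrow> real \<Rightarrow> mat3 \<Rightarrow> vec3 \<Rightarrow> vec3 \<Rightarrow> real \<Rightarrow> real \<Rightarrow> state \<Rightarrow> real"
  where
  "storage mH kc lbar kH MA pRr fcr lc0 V0 (pH, vH, pR, vR) =
     1 / 2 * (mH * (vH \<bullet> vH) + vR \<bullet> (MA *v vR) + (pRr - pR) \<bullet> (K_H kH *v (pRr - pR)))
     + (LBINT \<tau>=ereal lc0..ereal (norm (pR - pH)). tension kc lbar \<tau>)
     - (pR - pH) \<bullet> fcr + V0"

end

theory Submission
  imports Defs
begin

text \<open>
  The potential of the cable is \<open>kc/2 \<cdot> max 0 (\<parallel>l\<parallel> - lbar)\<^sup>2\<close>, whose gradient is the cable force; it is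
  \<open>C\<^sup>1\<close> also at \<open>l = 0\<close> because it vanishes near the origin. Minus the work \<open>l \<bullet> fcr\<close> of the constant
  reference force it is minimal at the reference configuration, where \<open>V\<close> is normalised to \<open>0\<close>, and
  the remaining terms of \<open>V\<close> are nonnegative. Along the dynamics all cable and control terms cancel;
  the gravity, ground reaction and \<open>fcr\<close> terms are vertical and so do no work on the horizontal
  velocity of the human. What remains is \<open>u \<bullet> v - v \<bullet> BH v - vR \<bullet> BA vR\<close>, so \<open>\<phi> v = BH v\<close> works.
\<close>

section \<open>Gradients\<close>

text \<open>The map \<open>blinfun_inner_right\<close> is itself bounded linear, so continuity of
  the gradient field passes to the operator norm.\<close>

lemma continuously_differentiableI_gradient:
  fixes V :: "'a::real_inner \<Rightarrow> real"
  assumes "\<And>x. (V has_derivative (\<lambda>h. G x \<bullet> h)) (at x)" "continuous_on UNIV G"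
  shows "continuously_differentiable V"
  unfolding continuously_differentiable_def
proof (intro exI conjI allI)
  show "(V has_derivative blinfun_apply (blinfun_inner_right (G x))) (at x)" for x
    using assms(1)[of x] by simp
  show "continuous_on UNIV (\<lambda>x. blinfun_inner_right (G x))"
    using assms(2) by (intro continuous_intros)
qed

section \<open>Diagonal and positive definite matrices\<close>

text \<open>Symmetry, absent from \<open>pos_def\<close>, comes from diagonality. It gives quadratic
  forms the gradient \<open>2 * (A *v x)\<close> and lets the mass matrix move across inner
  products.\<close>

lemma diagonal_symmetric:
  fixes A :: "real ^ 'n ^ 'n"
  assumes "diagonal A"
  shows "x \<bullet> (A *v y) = (A *v x) \<bullet> y"
proof -
  have "A $ i $ j = A $ j $ i" for i j
    using assms by (cases "i = j") (simp_all add: diagonal_def)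
  then have "transpose A = A"
    by (simp add: transpose_def vec_eq_iff)
  then show ?thesis
    using dot_lmul_matrix[of x "transpose A" y] unfolding vector_transpose_matrix by simp
qed

lemma has_derivative_quadratic_form:
  fixes A :: "real ^ 'n ^ 'n"
  assumes "diagonal A"
  shows "((\<lambda>x. x \<bullet> (A *v x)) has_derivative (\<lambda>h. 2 * ((A *v x) \<bullet> h))) (at x)"
proof -
  have "((\<lambda>x. A *v x) has_derivative (\<lambda>h. A *v h)) (at x)"
    by (intro bounded_linear_imp_has_derivative matrix_vector_mul_bounded_linear)
  from has_derivative_inner[OF has_derivative_ident this] show ?thesis
    by (rule has_derivative_eq_rhs) (simp add: diagonal_symmetric[OF assms, of x] inner_commute[of _ "A *v x"])
qed

lemma pos_def_nonneg: "pos_def A \<Longrightarrow> x \<bullet> (A *v x) \<ge> 0"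
  by (cases "x = 0") (auto simp: pos_def_def less_imp_le)

text \<open>A nonzero kernel vector would make the quadratic form vanish, so \<open>A\<close> is
  injective and hence invertible.\<close>

lemma pos_def_mult_matrix_inv:
  assumes "pos_def A"
  shows "A *v (matrix_inv A *v x) = x"
proof -
  have "x = 0" if "A *v x = 0" for x
    using assms that by (force simp: pos_def_def)
  then have "invertible A"
    by (simp add: invertible_left_inverse matrix_left_invertible_ker)
  then have "A ** matrix_inv A = mat 1"
    unfolding invertible_def matrix_inv_def by (rule someI2_ex) simp
  then show ?thesis
    by (simp add: matrix_vector_mul_assoc)
qed

lemma K_H_nth:
  "(K_H k *v x) $ 1 = k * x $ 1" "(K_H k *v x) $ 2 = k * x $ 2" "(K_H k *v x) $ 3 = 0"
  by (simp_all add: K_H_def matrix_vector_mult_def sum_3)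

lemma diagonal_K_H: "diagonal (K_H k)"
  by (simp add: diagonal_def K_H_def forall_3)

lemma K_H_nonneg:
  assumes "k > 0"
  shows "x \<bullet> (K_H k *v x) \<ge> 0"
proof -
  have "x \<bullet> (K_H k *v x) = k * ((x $ 1)\<^sup>2 + (x $ 2)\<^sup>2)"
    by (simp add: inner_vec_def sum_3 K_H_nth power2_eq_square algebra_simps)
  with assms show ?thesis by simp
qed

section \<open>The cable\<close>

definition cable_energy :: "real \<Rightarrow> real \<Rightarrow> real \<Rightarrow> real" where
  "cable_energy kc lbar l = kc / 2 * (max 0 (l - lbar))\<^sup>2"

lemma tension_eq_max: "tension kc lbar l = kc * max 0 (l - lbar)"
  by (auto simp: tension_def max_def)

lemma DERIV_max_0_power2: "((\<lambda>y::real. (max 0 y)\<^sup>2) has_real_derivative 2 * max 0 y) (at y)"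
proof -
  consider "y > 0" | "y < 0" | "y = 0" by linarith
  then show ?thesis
  proof cases
    case 1
    have "((\<lambda>y::real. y\<^sup>2) has_real_derivative 2 * max 0 y) (at y)"
      using 1 by (auto intro!: derivative_eq_intros)
    then show ?thesis
      by (rule has_field_derivative_transform_within_open[of _ _ _ "{0<..}"]) (use 1 in auto)
  next
    case 2
    have "((\<lambda>y::real. 0) has_real_derivative 2 * max 0 y) (at y)"
      using 2 by (auto intro!: derivative_eq_intros)
    then show ?thesis
      by (rule has_field_derivative_transform_within_open[of _ _ _ "{..<0}"]) (use 2 in auto)
  next
    case 3
    \<comment> \<open>For \<open>h \<noteq> 0\<close> the difference quotient
      \<open>(max 0 h)\<^sup>2 / h\<close> is just \<open>max 0 h\<close>.\<close>
    have "(\<lambda>h::real. max 0 h) \<midarrow>0\<rightarrow> max 0 0"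
      by (intro tendsto_intros)
    also have "?this \<longleftrightarrow> (\<lambda>h::real. (max 0 h)\<^sup>2 / h) \<midarrow>0\<rightarrow> 0"
      by (intro LIM_cong) (auto simp: max_def power2_eq_square)
    finally have "(\<lambda>h::real. (max 0 h)\<^sup>2 / h) \<midarrow>0\<rightarrow> 0" .
    then show ?thesis
      by (simp add: 3 DERIV_def)
  qed
qed

lemma cable_energy_DERIV:
  "(cable_energy kc lbar has_real_derivative tension kc lbar l) (at l)"
proof -
  have "((\<lambda>l. (max 0 (l - lbar))\<^sup>2) has_real_derivative 2 * max 0 (l - lbar) * 1) (at l)"
    by (rule DERIV_chain2[OF DERIV_max_0_power2]) (auto intro!: derivative_eq_intros)
  from DERIV_cmult[OF this, of "kc / 2"] show ?thesis
    by (simp add: cable_energy_def[abs_def] tension_eq_max)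
qed

text \<open>Turns the integral in the storage function into a difference of energies, where the
  initial length enters only as a constant.\<close>

lemma tension_interval_integral:
  "(LBINT \<tau>=ereal a..ereal b. tension kc lbar \<tau>) = cable_energy kc lbar b - cable_energy kc lbar a"
proof (rule interval_integral_FTC_finite)
  show "continuous_on {min a b..max a b} (tension kc lbar)"
    by (simp only: tension_eq_max[abs_def]) (intro continuous_intros)
  show "(cable_energy kc lbar has_vector_derivative tension kc lbar x)
          (at x within {min a b..max a b})" for x
    using cable_energy_DERIV
    by (auto simp: has_real_derivative_iff_has_vector_derivative
        intro: has_vector_derivative_at_within)
qed

lemma cable_energy_has_derivative:
  assumes "lbar > 0"
  shows "((\<lambda>l. cable_energy kc lbar (norm l)) has_derivative (\<lambda>h. cable_force kc lbar l \<bullet> h)) (at l)"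
proof (cases "l = 0")
  case True
  \<comment> \<open>The force at the origin is a multiple of the zero vector; within radius
    \<open>lbar\<close> the cable is slack and its energy constantly \<open>0\<close>.\<close>
  have "((\<lambda>l. 0) has_derivative (\<lambda>h. cable_force kc lbar l \<bullet> h)) (at l)"
    by (simp add: True cable_force_def)
  then show ?thesis
    by (rule has_derivative_transform_within_open[of _ _ _ _ "ball 0 lbar"])
       (use assms True in \<open>auto simp: cable_energy_def\<close>)
next
  case False
  have "(cable_energy kc lbar has_derivative (\<lambda>h. tension kc lbar (norm l) * h)) (at (norm l))"
    using cable_energy_DERIV by (simp add: has_field_derivative_def)
  from has_derivative_compose[OF has_derivative_norm[OF False] this] show ?thesis
    by (rule has_derivative_eq_rhs)
       (simp add: cable_force_def sgn_div_norm inner_commute divide_inverse mult_ac)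
qed

lemma continuous_on_cable_force:
  assumes "lbar > 0"
  shows "continuous_on UNIV (cable_force kc lbar)"
proof -
  \<comment> \<open>The denominator may be bounded away from \<open>0\<close> since the tension vanishes below \<open>lbar\<close>.\<close>
  have "cable_force kc lbar = (\<lambda>l. (kc * max 0 (norm l - lbar) / max lbar (norm l)) *\<^sub>R l)"
    by (auto simp: cable_force_def tension_eq_max max_def fun_eq_iff)
  moreover have "max lbar (norm l) \<noteq> 0" for l :: vec3
    using assms by linarith
  ultimately show ?thesis
    by (auto intro!: continuous_intros)
qed

text \<open>Completing the square in the stretch \<open>m\<close> puts the minimum at
  \<open>m = fz / kc\<close>, where tension balances \<open>fz\<close>. Slack lengths are covered by
  \<open>s - lbar \<le> m\<close>.\<close>

lemma cable_energy_minimum: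
  assumes "kc > 0" "fz > 0" "s \<ge> 0"
  shows "cable_energy kc lbar (fz / kc + lbar) - fz * (fz / kc + lbar)
           \<le> cable_energy kc lbar s - fz * s"
proof -
  define m where "m = max 0 (s - lbar)"
  have "0 \<le> kc / 2 * (m - fz / kc)\<^sup>2"
    using assms by simp
  also have "\<dots> = kc / 2 * m\<^sup>2 - fz * m + fz\<^sup>2 / (2 * kc)"
    using assms by (simp add: power2_eq_square field_simps)
  finally have "fz * m - fz\<^sup>2 / (2 * kc) \<le> kc / 2 * m\<^sup>2" by linarith
  moreover have "fz * (s - lbar) \<le> fz * m"
    using assms by (simp add: m_def)
  moreover have "max 0 (fz / kc) = fz / kc"
    using assms by simp
  then have "cable_energy kc lbar (fz / kc + lbar) = fz\<^sup>2 / (2 * kc)"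
    using assms by (simp add: cable_energy_def power2_eq_square)
  moreover have "fz * (fz / kc + lbar) = 2 * (fz\<^sup>2 / (2 * kc)) + fz * lbar"
    by (simp add: power2_eq_square distrib_left)
  ultimately show ?thesis
    unfolding cable_energy_def m_def[symmetric] right_diff_distrib by linarith
qed

section \<open>The storage function\<close>

lemma storage_eq:
  "storage mH kc lbar kH MA pRr fcr lc0 V0 (pH, vH, pR, vR) =
     1 / 2 * (mH * (vH \<bullet> vH) + vR \<bullet> (MA *v vR) + (pRr - pR) \<bullet> (K_H kH *v (pRr - pR)))
     + (cable_energy kc lbar (norm (pR - pH)) - cable_energy kc lbar lc0)
     - (pR - pH) \<bullet> fcr + V0"
  by (simp only: storage.simps tension_interval_integral)

fun storage_gradient ::
  "real \<Rightarrow> real \<Rightarrow> real \<Rightarrow> real \<Rightarrow> mat3 \<Rightarrow> vec3 \<Rightarrow> vec3 \<Rightarrow> state \<Rightarrow> state" where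
  "storage_gradient mH kc lbar kH MA pRr fcr (pH, vH, pR, vR) =
     (fcr - cable_force kc lbar (pR - pH),
      mH *\<^sub>R vH,
      cable_force kc lbar (pR - pH) - fcr - K_H kH *v (pRr - pR),
      MA *v vR)"

lemma storage_has_derivative:
  assumes "lbar > 0" "diagonal MA"
  shows "(storage mH kc lbar kH MA pRr fcr lc0 V0 has_derivative
           (\<lambda>h. storage_gradient mH kc lbar kH MA pRr fcr x \<bullet> h)) (at x)"
proof -
  obtain pH vH pR vR where x: "x = (pH, vH, pR, vR)"
    by (metis prod_cases4)
  \<comment> \<open>Projections replace pattern matching so that the derivative rules apply term by
    term.\<close>
  have V: "storage mH kc lbar kH MA pRr fcr lc0 V0 = (\<lambda>x.
     1 / 2 * (mH * (fst (snd x) \<bullet> fst (snd x)) + snd (snd (snd x)) \<bullet> (MA *v snd (snd (snd x)))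
       + (pRr - fst (snd (snd x))) \<bullet> (K_H kH *v (pRr - fst (snd (snd x)))))
     + (cable_energy kc lbar (norm (fst (snd (snd x)) - fst x)) - cable_energy kc lbar lc0)
     - (fst (snd (snd x)) - fst x) \<bullet> fcr + V0)"
    by (auto simp: fun_eq_iff storage_eq simp del: storage.simps)
  note [derivative_intros] =
    has_derivative_compose[OF _ has_derivative_quadratic_form[OF assms(2)]]
    has_derivative_compose[OF _ has_derivative_quadratic_form[OF diagonal_K_H]]
    has_derivative_compose[OF _ cable_energy_has_derivative[OF assms(1)]]
  show ?thesis
    unfolding V
    by (rule has_derivative_eq_rhs, (rule derivative_intros)+)
       (simp add: x fun_eq_iff inner_commute algebra_simps)
qed

lemma continuous_on_storage_gradient:
  assumes "lbar > 0"
  shows "continuous_on UNIV (storage_gradient mH kc lbar kH MA pRr fcr)"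
proof -
  have G: "storage_gradient mH kc lbar kH MA pRr fcr = (\<lambda>x.
      (fcr - cable_force kc lbar (fst (snd (snd x)) - fst x),
       mH *\<^sub>R fst (snd x),
       cable_force kc lbar (fst (snd (snd x)) - fst x) - fcr
         - K_H kH *v (pRr - fst (snd (snd x))),
       MA *v snd (snd (snd x))))"
    by (auto simp: fun_eq_iff)
  note [continuous_intros] =
    continuous_on_compose2[OF continuous_on_cable_force[OF assms], OF _ subset_UNIV]
    continuous_on_compose2[OF matrix_vector_mult_linear_continuous_on, OF _ subset_UNIV]
  show ?thesis
    unfolding G by (intro continuous_intros)
qed

text \<open>The reaction is orthogonal to \<open>vH\<close> whatever its intensity, so
  \<open>reaction_intensity\<close> is never evaluated. Symmetry of \<open>MA\<close> lets it cancel
  its inverse in the robot term.\<close>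

lemma storage_gradient_closed_loop:
  assumes "mH > 0" "pos_def MA" "diagonal MA"
    and vert: "fcr = fz *\<^sub>R z_W" and vH: "z_W \<bullet> vH = 0"
  shows "storage_gradient mH kc lbar kH MA pRr fcr (pH, vH, pR, vR)
           \<bullet> closed_loop mH g kc lbar kH BH MA BA pRr fcr (pH, vH, pR, vR) u
         = u \<bullet> vH - vH \<bullet> (BH *v vH) - vR \<bullet> (BA *v vR)"
proof -
  have vH': "vH \<bullet> z_W = 0"
    using vH by (simp add: inner_commute)
  show ?thesis
    using assms(1)
    by (simp add: Let_def human_acceleration_def control_law_def vert vH vH'
        diagonal_symmetric[OF assms(3), symmetric] pos_def_mult_matrix_inv[OF assms(2)]
        inner_diff_left inner_diff_right inner_add_left inner_add_right)
      (simp add: inner_commute field_simps)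
qed

lemma storage_nonneg:
  assumes "mH > 0" "kc > 0" "kH > 0" "lbar > 0" "fz > 0" "pos_def MA"
    and fcr: "fcr = fz *\<^sub>R z_W"
    and pRr: "pRr = pHr + (1 / kc + lbar / norm fcr) *\<^sub>R fcr"
    and zero: "storage mH kc lbar kH MA pRr fcr lc0 V0 (pHr, 0, pRr, 0) = 0"
  shows "storage mH kc lbar kH MA pRr fcr lc0 V0 x \<ge> 0"
proof -
  obtain pH vH pR vR where x: "x = (pH, vH, pR, vR)"
    by (metis prod_cases4)
  have z: "norm z_W = 1"
    by (simp add: z_W_def)
  define L where "L = fz / kc + lbar"
  have "L > 0"
    using assms(2,4,5) by (simp add: L_def add_pos_pos)
  \<comment> \<open>The reference cable is vertical: rest length \<open>lbar\<close> plus the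
    stretch \<open>fz / kc\<close> that produces tension \<open>fz\<close>.\<close>
  have "pRr - pHr = L *\<^sub>R z_W"
    using assms(2,5) by (simp add: pRr fcr z L_def field_simps)
  then have zero': "cable_energy kc lbar L - cable_energy kc lbar lc0 - fz * L + V0 = 0"
    using zero \<open>L > 0\<close> by (simp add: storage_eq fcr z dot_square_norm del: storage.simps)
  \<comment> \<open>Cauchy-Schwarz reduces the bound to a function of the cable length
    alone.\<close>
  have "(pR - pH) \<bullet> fcr \<le> norm (pR - pH) * norm fcr"
    by (rule norm_cauchy_schwarz)
  then have "(pR - pH) \<bullet> fcr \<le> fz * norm (pR - pH)"
    using assms(5) by (simp add: fcr z mult.commute)
  moreover have "cable_energy kc lbar L - fz * L
      \<le> cable_energy kc lbar (norm (pR - pH)) - fz * norm (pR - pH)"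
    unfolding L_def using assms(2,5) by (intro cable_energy_minimum) auto
  moreover have "0 \<le> 1 / 2 * (mH * (vH \<bullet> vH) + vR \<bullet> (MA *v vR)
      + (pRr - pR) \<bullet> (K_H kH *v (pRr - pR)))"
    using assms(1,3,6) by (simp add: pos_def_nonneg K_H_nonneg)
  ultimately show ?thesis
    unfolding x storage_eq using zero' by linarith
qed

theorem theorem3:
  fixes mH g kc lbar kH fz lc0 V0 :: real
    and BH MA BA :: mat3
    and pHr fcr pRr :: vec3
    and x0 :: state
  assumes "mH > 0" "g > 0" "kc > 0" "lbar > 0" "kH > 0"
    and "pos_def BH"
    and "pos_def MA" "diagonal MA"
    and "pos_def BA" "diagonal BA"
    and "z_W \<bullet> pHr = 0"
    and "0 < fz" "fz < mH * g"
    and "fcr = fz *\<^sub>R z_W"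
    and "pRr = pHr + (1 / kc + lbar / norm fcr) *\<^sub>R fcr"
    and "x0 \<in> state_space"
    and "lc0 = norm (cable_vector x0)"
    and "storage mH kc lbar kH MA pRr fcr lc0 V0 (pHr, 0, pRr, 0) = 0"
  shows "output_strictly_passive state_space
           (closed_loop mH g kc lbar kH BH MA BA pRr fcr)
           (\<lambda>x u. human_velocity x)
           (storage mH kc lbar kH MA pRr fcr lc0 V0)"
  unfolding output_strictly_passive_def
proof (intro conjI exI ballI allI impI)
  let ?V = "storage mH kc lbar kH MA pRr fcr lc0 V0"
  note D = storage_has_derivative[OF assms(4,8)]
  show "continuously_differentiable ?V"
    using D continuous_on_storage_gradient[OF assms(4)]
    by (rule continuously_differentiableI_gradient)
  show "?V x \<ge> 0" for x
    by (rule storage_nonneg[OF assms(1,3,5,4,12,7,14,15,18)])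
  \<comment> \<open>Unification with this goal fixes the witness for \<open>\<phi>\<close>.\<close>
  show "y \<bullet> (BH *v y) > 0" if "y \<noteq> 0" for y
    using \<open>pos_def BH\<close> that by (simp add: pos_def_def)
  fix x u assume "x \<in> state_space"
  then obtain pH vH pR vR where x: "x = (pH, vH, pR, vR)" and vH: "z_W \<bullet> vH = 0"
    by (auto simp: state_space_def)
  \<comment> \<open>The robot damping is not a function of the output; its sign lets it be dropped,
    leaving an inequality.\<close>
  have "vR \<bullet> (BA *v vR) \<ge> 0"
    using \<open>pos_def BA\<close> by (rule pos_def_nonneg)
  then show "frechet_derivative ?V (at x) (closed_loop mH g kc lbar kH BH MA BA pRr fcr x u)
      \<le> u \<bullet> human_velocity x - human_velocity x \<bullet> (BH *v human_velocity x)"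
    using storage_gradient_closed_loop[OF assms(1,7,8,14) vH]
    by (simp add: frechet_derivative_at[OF D, symmetric] x
        del: closed_loop.simps storage_gradient.simps)
qed

end
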